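(* Let $r\ge 3$, let $\theta=\alpha_1+\cdots+\alpha_r$ be the highest root of $\mathfrak{sl}_{r+1}(\mathbb{C})$, fix $i\in[r-2]$ and let $j\in[r-i-1]$. Then \[ m_q(\theta,\alpha_{1,i}+\alpha_{i+j+1,r})=q^j-q^{j-1}. \]
   Context: Notation: $[n]=\{1,\dots,n\}$. In $\mathfrak{sl}_{r+1}(\mathbb{C})$, with $e_1,\dots,e_{r+1}$ the standard basis of $\mathbb{R}^{r+1}$, the simple roots are $\alpha_i=e_i-e_{i+1}$ ($i\in[r]$), the positive roots are $\alpha_{i,j}=\alpha_i+\cdots+\alpha_j$ for $1\le i\le j\le r$, the highest root is $\theta=\alpha_{1,r}$, and $\rho$ is half the sum of the positive roots. The Weyl group $W\cong\mathfrak{S}_{r+1}$ is generated by the simple reflections $s_i$ (reflection through the hyperplane orthogonal to $\alpha_i$), and $\ell(\sigma)$ is the length of $\sigma\in W$. The $q$-analog of Kostant's partition function is $\wp_q(\xi)=\sum_{k\ge0}c_kq^k$, where $c_k$ is the number of ways to write $\xi$ as a sum of exactly $k$ positive roots (unordered, with repetition allowed); in particular $\wp_q(0)=1$ and $\wp_q(\xi)=0$ if $\xi$ is not a nonnegative integral combination of positive roots. The $q$-analog of Kostant's weight multiplicity formula is $m_q(\lambda,\mu)=\sum_{\sigma\in W}(-1)^{\ell(\sigma)}\wp_q(\sigma(\lambda+\rho)-\rho-\mu)$. *)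

theory Defs
  imports
    Complex_Main
    "HOL-Library.Function_Algebras"
    "HOL-Library.Multiset"
    "HOL-Computational_Algebra.Polynomial"
    "HOL-Combinatorics.Permutations"
begin

text \<open>
  Since the coordinates of \<open>\<real>\<^bsup>r+1\<^esup>\<close> are ordered and \<open>r\<close> is a term, vectors are functions
  \<^typ>\<open>nat \<Rightarrow> real\<close> whose relevant coordinates are those in \<open>{1..r+1}\<close>; every vector built below
  vanishes elsewhere. Addition and subtraction are pointwise.
\<close>

definition std_basis :: "nat \<Rightarrow> nat \<Rightarrow> real" where
  "std_basis i = (\<lambda>k. if k = i then 1 else 0)"

definition dot :: "nat \<Rightarrow> (nat \<Rightarrow> real) \<Rightarrow> (nat \<Rightarrow> real) \<Rightarrow> real" where
  "dot r u v = (\<Sum>k=1..r+1. u k * v k)"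

definition simple_root :: "nat \<Rightarrow> nat \<Rightarrow> real" where
  "simple_root i = std_basis i - std_basis (i + 1)"

definition root_seg :: "nat \<Rightarrow> nat \<Rightarrow> nat \<Rightarrow> real" where
  "root_seg i j = (\<Sum>k=i..j. simple_root k)"

definition pos_roots :: "nat \<Rightarrow> (nat \<Rightarrow> real) set" where
  "pos_roots r = {root_seg i j | i j. 1 \<le> i \<and> i \<le> j \<and> j \<le> r}"

definition highest_root :: "nat \<Rightarrow> nat \<Rightarrow> real" where
  "highest_root r = root_seg 1 r"

definition weyl_rho :: "nat \<Rightarrow> nat \<Rightarrow> real" where
  "weyl_rho r = (\<lambda>k. (1 / 2) * (\<Sum>\<beta>\<in>pos_roots r. \<beta>) k)"

definition simple_reflection :: "nat \<Rightarrow> nat \<Rightarrow> (nat \<Rightarrow> real) \<Rightarrow> (nat \<Rightarrow> real)" where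
  "simple_reflection r i v =
     (\<lambda>k. v k - 2 * dot r v (simple_root i) / dot r (simple_root i) (simple_root i) * simple_root i k)"

definition word_action :: "nat \<Rightarrow> nat list \<Rightarrow> (nat \<Rightarrow> real) \<Rightarrow> (nat \<Rightarrow> real)" where
  "word_action r w = foldr (\<lambda>i \<sigma>. simple_reflection r i \<circ> \<sigma>) w id"

text \<open>
  The simple reflections are involutions (\<open>simple_reflection_involution\<close> below), so the group they
  generate consists of the words in them, without inverses.
\<close>

definition weyl_group :: "nat \<Rightarrow> ((nat \<Rightarrow> real) \<Rightarrow> (nat \<Rightarrow> real)) set" where
  "weyl_group r = {word_action r w | w. set w \<subseteq> {1..r}}"

definition weyl_length :: "nat \<Rightarrow> ((nat \<Rightarrow> real) \<Rightarrow> (nat \<Rightarrow> real)) \<Rightarrow> nat" where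
  "weyl_length r \<sigma> = (LEAST k. \<exists>w. length w = k \<and> set w \<subseteq> {1..r} \<and> word_action r w = \<sigma>)"

definition root_partitions :: "nat \<Rightarrow> (nat \<Rightarrow> real) \<Rightarrow> nat \<Rightarrow> (nat \<Rightarrow> real) multiset set" where
  "root_partitions r \<xi> k = {M. set_mset M \<subseteq> pos_roots r \<and> size M = k \<and> \<Sum>\<^sub># M = \<xi>}"

text \<open>
  The sum is over the exponents with nonzero coefficient, of which there are finitely many
  (\<open>finite_exponents\<close>); \<open>coeff_kostant_q\<close> reads off the coefficients.
\<close>

definition kostant_q :: "nat \<Rightarrow> (nat \<Rightarrow> real) \<Rightarrow> int poly" where
  "kostant_q r \<xi> =
     (\<Sum>k | card (root_partitions r \<xi> k) \<noteq> 0. monom (int (card (root_partitions r \<xi> k))) k)"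

definition weight_mult_q :: "nat \<Rightarrow> (nat \<Rightarrow> real) \<Rightarrow> (nat \<Rightarrow> real) \<Rightarrow> int poly" where
  "weight_mult_q r lam \<mu> =
     (\<Sum>\<sigma>\<in>weyl_group r.
        (-1) ^ weyl_length r \<sigma> * kostant_q r (\<sigma> (lam + weyl_rho r) - weyl_rho r - \<mu>))"


lemma dot_simple_root:
  assumes "i \<in> {1..r}"
  shows "dot r v (simple_root i) = v i - v (i + 1)"
proof -
  have "dot r v (simple_root i) =
      (\<Sum>k=1..r+1. (if k = i then v k else 0) - (if k = i + 1 then v k else 0))"
    unfolding dot_def by (rule sum.cong) (auto simp: simple_root_def std_basis_def)
  also have "\<dots> = v i - v (i + 1)"
    using assms by (simp add: sum_subtractf)
  finally show ?thesis .
qed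

lemma simple_reflection_transpose:
  assumes "i \<in> {1..r}"
  shows "simple_reflection r i v = v \<circ> Transposition.transpose i (i + 1)"
  unfolding simple_reflection_def dot_simple_root[OF assms]
  by (auto simp: fun_eq_iff simple_root_def std_basis_def Transposition.transpose_def field_simps)

lemma simple_reflection_involution:
  assumes "i \<in> {1..r}"
  shows "simple_reflection r i (simple_reflection r i v) = v"
  by (simp add: simple_reflection_transpose[OF assms] comp_assoc)

lemma word_action_permutes:
  assumes "set w \<subseteq> {1..r}"
  shows "\<exists>p. p permutes {1..r+1} \<and> word_action r w = (\<lambda>v. v \<circ> p)"
  using assms
proof (induction w)
  case Nil
  show ?case by (rule exI[of _ id]) (simp add: word_action_def permutes_id id_def[symmetric])
next
  case (Cons i w)
  then obtain p where p: "p permutes {1..r+1}" "word_action r w = (\<lambda>v. v \<circ> p)"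
    by (meson set_subset_Cons subset_trans)
  have i: "i \<in> {1..r}" using Cons.prems by simp
  have "Transposition.transpose i (i + 1) permutes {1..r+1}"
    using i by (intro permutes_swap_id) auto
  then have "(p \<circ> Transposition.transpose i (i + 1)) permutes {1..r+1}"
    using p(1) by (rule permutes_compose)
  moreover have "word_action r (i # w) = (\<lambda>v. v \<circ> (p \<circ> Transposition.transpose i (i + 1)))"
    using p(2) simple_reflection_transpose[OF i]
    by (auto simp: word_action_def fun_eq_iff)
  ultimately show ?case by blast
qed

lemma finite_weyl_group: "finite (weyl_group r)"
proof (rule finite_subset)
  show "weyl_group r \<subseteq> (\<lambda>p v. v \<circ> p) ` {p. p permutes {1..r+1}}"
    unfolding weyl_group_def using word_action_permutes by fastforce
qed (simp add: finite_permutations)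

lemma finite_pos_roots: "finite (pos_roots r)"
proof (rule finite_subset)
  show "pos_roots r \<subseteq> (\<lambda>(i, j). root_seg i j) ` ({1..r} \<times> {1..r})"
    unfolding pos_roots_def by force
qed simp

lemma finite_root_partitions: "finite (root_partitions r \<xi> k)"
proof (rule finite_subset)
  show "root_partitions r \<xi> k \<subseteq> {M. set_mset M \<subseteq> pos_roots r \<and> size M = k}"
    unfolding root_partitions_def by blast
  have "{M. set_mset M \<subseteq> pos_roots r \<and> size M = k}
      \<subseteq> mset ` {xs. set xs \<subseteq> pos_roots r \<and> length xs = k}"
  proof
    fix M assume M: "M \<in> {M. set_mset M \<subseteq> pos_roots r \<and> size M = k}"
    obtain xs where "mset xs = M" using ex_mset by blast
    then show "M \<in> mset ` {xs. set xs \<subseteq> pos_roots r \<and> length xs = k}" using M by auto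
  qed
  then show "finite {M. set_mset M \<subseteq> pos_roots r \<and> size M = k}"
    by (rule finite_subset) (intro finite_imageI finite_lists_length_eq finite_pos_roots)
qed

definition height_fun :: "nat \<Rightarrow> (nat \<Rightarrow> real) \<Rightarrow> real" where
  "height_fun r v = (\<Sum>k=1..r+1. - real k * v k)"

lemma height_fun_add: "height_fun r (u + v) = height_fun r u + height_fun r v"
  unfolding height_fun_def sum.distrib[symmetric]
  by (rule sum.cong) (simp_all add: algebra_simps)

lemma height_fun_sum: "height_fun r (\<Sum>x\<in>A. f x) = (\<Sum>x\<in>A. height_fun r (f x))"
proof (induction A rule: infinite_finite_induct)
  case (insert x A)
  then show ?case by (simp add: height_fun_add del: plus_fun_apply)
qed (auto simp: height_fun_def)

lemma height_simple_root: "i \<in> {1..r} \<Longrightarrow> height_fun r (simple_root i) = 1"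
  using dot_simple_root[of i r "\<lambda>k. - real k"] by (simp add: dot_def height_fun_def)

lemma height_pos_root:
  assumes "\<beta> \<in> pos_roots r"
  shows "height_fun r \<beta> \<ge> 1"
proof -
  obtain i j where ij: "\<beta> = root_seg i j" "1 \<le> i" "i \<le> j" "j \<le> r"
    using assms unfolding pos_roots_def by blast
  have "height_fun r \<beta> = (\<Sum>k=i..j. 1)"
    unfolding ij(1) root_seg_def height_fun_sum
    by (rule sum.cong) (use ij height_simple_root in auto)
  then show ?thesis using ij by simp
qed

lemma size_le_height:
  "set_mset M \<subseteq> pos_roots r \<Longrightarrow> real (size M) \<le> height_fun r (\<Sum>\<^sub># M)"
proof (induction M)
  case empty
  show ?case by (simp add: height_fun_def)
next
  case (add \<beta> M)
  then have "real (size M) \<le> height_fun r (\<Sum>\<^sub># M)" "1 \<le> height_fun r \<beta>"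
    using height_pos_root by auto
  then show ?case by (simp add: height_fun_add del: plus_fun_apply)
qed

lemma finite_exponents: "finite {k. card (root_partitions r \<xi> k) \<noteq> 0}"
proof (rule finite_subset)
  show "{k. card (root_partitions r \<xi> k) \<noteq> 0} \<subseteq> {..nat \<lfloor>height_fun r \<xi>\<rfloor>}"
  proof
    fix k assume "k \<in> {k. card (root_partitions r \<xi> k) \<noteq> 0}"
    then have "root_partitions r \<xi> k \<noteq> {}" by auto
    then have "real k \<le> height_fun r \<xi>"
      unfolding root_partitions_def using size_le_height by auto
    then show "k \<in> {..nat \<lfloor>height_fun r \<xi>\<rfloor>}" by (simp add: le_nat_floor)
  qed
qed simp

lemma coeff_kostant_q: "coeff (kostant_q r \<xi>) k = int (card (root_partitions r \<xi> k))"
  unfolding kostant_q_def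
  using finite_exponents[of r \<xi>] by (simp add: coeff_sum)

end

theory Submission
  imports Defs
begin

text \<open>
  Write \<open>\<mu>\<close> for the second weight; \<open>\<theta> - \<mu>\<close> is the sum of the consecutive simple roots
  \<open>\<alpha>\<^sub>k\<close>, \<open>i < k \<le> i + j\<close>. For a permutation \<open>\<sigma>\<close>, the coefficients of
  \<open>\<sigma>(\<theta> + \<rho>) - (\<theta> + \<rho>)\<close> are nonpositive, so \<open>\<wp>\<^sub>q\<close> can only be nonzero at
  \<open>\<sigma>(\<theta> + \<rho>) - \<rho> - \<mu>\<close> if they are at least \<open>-1\<close>, and \<open>0\<close> outside the interval. This
  forces \<open>\<sigma>\<close> to be a product of simple reflections \<open>s\<^sub>k\<close> with \<open>k\<close> in a set \<open>S\<close> of pairwise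
  nonconsecutive elements of the interval, and then the argument of \<open>\<wp>\<^sub>q\<close> is the sum of the
  \<open>\<alpha>\<^sub>k\<close> with \<open>k\<close> in the interval but not in \<open>S\<close>. Lengthening the interval by one multiplies
  the alternating sum over \<open>S\<close> by \<open>q\<close>, and for length \<open>1\<close> it is \<open>q - 1\<close>.
\<close>

section \<open>Coordinates with respect to the simple roots\<close>

text \<open>For \<open>v\<close> in the span of the roots, the coefficient of \<open>\<alpha>\<^sub>k\<close> in \<open>v\<close> is a partial sum of its
  coordinates.\<close>

definition root_coeff :: "nat \<Rightarrow> (nat \<Rightarrow> real) \<Rightarrow> real" where
  "root_coeff k v = (\<Sum>l=1..k. v l)"

lemma root_coeff_0 [simp]: "root_coeff k 0 = 0"
  by (simp add: root_coeff_def)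

lemma root_coeff_add: "root_coeff k (u + v) = root_coeff k u + root_coeff k v"
  by (simp add: root_coeff_def sum.distrib)

lemma root_coeff_sum: "root_coeff k (\<Sum>x\<in>A. f x) = (\<Sum>x\<in>A. root_coeff k (f x))"
  by (induction A rule: infinite_finite_induct)
    (simp_all add: root_coeff_add del: plus_fun_apply zero_fun_apply)

lemma root_coeff_simple_root:
  assumes "m \<ge> 1"
  shows "root_coeff k (simple_root m) = (if k = m then 1 else 0)"
proof -
  have "root_coeff k (simple_root m) =
      (\<Sum>l=1..k. if l = m then 1 else 0) - (\<Sum>l=1..k. if l = m + 1 then 1 else 0)"
    by (simp add: root_coeff_def simple_root_def std_basis_def sum_subtractf)
  then show ?thesis using assms by auto
qed

definition support_root :: "nat set \<Rightarrow> nat \<Rightarrow> real" where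
  "support_root T = (\<Sum>k\<in>T. simple_root k)"

lemma root_seg_eq_support_root: "root_seg c d = support_root {c..d}"
  by (simp add: root_seg_def support_root_def)

text \<open>The index 0 is excluded because the partial sums start at coordinate 1, where
  \<open>simple_root 0\<close> has the entry -1.\<close>

lemma root_coeff_support_root:
  assumes "finite T" "0 \<notin> T"
  shows "root_coeff k (support_root T) = (if k \<in> T then 1 else 0)"
proof -
  have "root_coeff k (support_root T) = (\<Sum>m\<in>T. if k = m then 1 else 0)"
    unfolding support_root_def root_coeff_sum
  proof (rule sum.cong[OF refl])
    fix m assume "m \<in> T"
    then have "m \<ge> 1" using assms(2) by (cases m) auto
    then show "root_coeff k (simple_root m) = (if k = m then 1 else 0)"
      by (rule root_coeff_simple_root)
  qed
  then show ?thesis using assms by simp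
qed

lemma support_root_diff:
  assumes "finite T" "A \<subseteq> T"
  shows "support_root (T - A) = support_root T - support_root A"
  unfolding support_root_def by (rule sum_diff) (use assms in auto)

lemma root_coeff_root_seg:
  assumes "c \<ge> 1"
  shows "root_coeff k (root_seg c d) = (if c \<le> k \<and> k \<le> d then 1 else 0)"
  using assms by (simp add: root_seg_eq_support_root root_coeff_support_root)

lemma root_coeff_pos_root_nonneg: "\<beta> \<in> pos_roots r \<Longrightarrow> root_coeff k \<beta> \<ge> 0"
  by (auto simp: pos_roots_def root_coeff_root_seg)

lemma root_coeff_sum_mset_nonneg:
  "set_mset M \<subseteq> pos_roots r \<Longrightarrow> root_coeff k (\<Sum>\<^sub># M) \<ge> 0"
  by (induction M) (auto simp: root_coeff_add root_coeff_pos_root_nonneg simp del: plus_fun_apply)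

lemma root_coeff_le_sum_mset:
  assumes "set_mset M \<subseteq> pos_roots r" "\<beta> \<in># M"
  shows "root_coeff k \<beta> \<le> root_coeff k (\<Sum>\<^sub># M)"
proof -
  obtain M' where M': "M = add_mset \<beta> M'" using assms(2) by (metis insert_DiffM)
  then have "root_coeff k (\<Sum>\<^sub># M') \<ge> 0"
    using assms(1) root_coeff_sum_mset_nonneg by auto
  then show ?thesis by (simp add: M' root_coeff_add del: plus_fun_apply)
qed

lemma root_coeff_sum_mset_eq_0:
  "(\<And>\<beta>. \<beta> \<in># M \<Longrightarrow> root_coeff k \<beta> = 0) \<Longrightarrow> root_coeff k (\<Sum>\<^sub># M) = 0"
  by (induction M) (auto simp: root_coeff_add simp del: plus_fun_apply)

lemma kostant_q_eq_0:
  assumes "root_coeff k \<xi> < 0"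
  shows "kostant_q r \<xi> = 0"
proof (rule poly_eqI)
  fix n
  have "root_partitions r \<xi> n = {}"
  proof (rule ccontr)
    assume "root_partitions r \<xi> n \<noteq> {}"
    then obtain M where "set_mset M \<subseteq> pos_roots r" "\<Sum>\<^sub># M = \<xi>"
      by (auto simp: root_partitions_def)
    then show False using root_coeff_sum_mset_nonneg[of M r k] assms by simp
  qed
  then show "coeff (kostant_q r \<xi>) n = coeff 0 n" by (simp add: coeff_kostant_q)
qed

section \<open>Kostant's partition function on multiplicity-free sums of simple roots\<close>

text \<open>In a partition of a multiplicity-free sum with largest simple root \<open>\<alpha>\<^sub>m\<close>, exactly one part
  contains \<open>\<alpha>\<^sub>m\<close>, and it ends there.\<close>

lemma root_partitions_support_root_Suc:
  assumes T: "T \<subseteq> {1..r}" and m: "m \<in> T" "\<And>k. k \<in> T \<Longrightarrow> k \<le> m"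
  shows "root_partitions r (support_root T) (Suc n) =
    (\<Union>c\<in>{c. 1 \<le> c \<and> c \<le> m \<and> {c..m} \<subseteq> T}.
      add_mset (root_seg c m) ` root_partitions r (support_root (T - {c..m})) n)"
    (is "?L = ?R")
proof (intro equalityI subsetI)
  have fT: "finite T" "0 \<notin> T" using T finite_subset by auto
  {
    fix M assume "M \<in> ?L"
    then have M: "set_mset M \<subseteq> pos_roots r" "size M = Suc n" "\<Sum>\<^sub># M = support_root T"
      by (auto simp: root_partitions_def)
    have "root_coeff m (\<Sum>\<^sub># M) = 1" using M fT m by (simp add: root_coeff_support_root)
    then obtain \<beta> where \<beta>: "\<beta> \<in># M" "root_coeff m \<beta> \<noteq> 0"
      using root_coeff_sum_mset_eq_0[of M m] by fastforce
    then obtain c d where cd: "\<beta> = root_seg c d" "1 \<le> c" "c \<le> d"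
      using M(1) by (auto simp: pos_roots_def)
    then have cmd: "c \<le> m" "m \<le> d"
      using \<beta>(2) by (auto simp: root_coeff_root_seg split: if_splits)
    \<comment> \<open>A part cannot exceed the sum in any coefficient, so its interval lies in
      \<open>T\<close>; maximality of \<open>m\<close> then ends it at \<open>m\<close>.\<close>
    have sub: "l \<in> T" if "l \<in> {c..d}" for l
    proof (rule ccontr)
      assume "l \<notin> T"
      then show False
        using root_coeff_le_sum_mset[OF M(1) \<beta>(1), of l] M(3) fT cd that
        by (simp add: root_coeff_support_root root_coeff_root_seg)
    qed
    then have "d = m" using m(2)[of d] cd cmd by auto
    with sub have cT: "{c..m} \<subseteq> T" by auto
    obtain M' where M': "M = add_mset \<beta> M'" using \<beta>(1) by (metis insert_DiffM)
    have "\<Sum>\<^sub># M' = support_root T - root_seg c m"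
      using M(3) cd \<open>d = m\<close> by (simp add: M' algebra_simps)
    then have "M' \<in> root_partitions r (support_root (T - {c..m})) n"
      using M M' fT cT
      by (simp add: root_partitions_def support_root_diff root_seg_eq_support_root)
    then show "M \<in> ?R" using M' cd cmd \<open>d = m\<close> cT by auto
  next
    fix M assume "M \<in> ?R"
    then obtain c M' where c: "1 \<le> c" "c \<le> m" "{c..m} \<subseteq> T"
      and M': "M = add_mset (root_seg c m) M'"
        "M' \<in> root_partitions r (support_root (T - {c..m})) n"
      by auto
    have "root_seg c m \<in> pos_roots r" using c T m unfolding pos_roots_def by fastforce
    then show "M \<in> ?L"
      using M' c fT by (auto simp: root_partitions_def support_root_diff root_seg_eq_support_root)
  }
qed

text \<open>Compare coefficients: the part ending at \<open>m\<close> supplies the factor q, and its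
  left end \<open>c\<close> indexes disjoint cases. The constant term vanishes because
  \<open>support_root T\<close> is nonzero.\<close>

lemma kostant_q_support_root_peel:
  assumes T: "T \<subseteq> {1..r}" and m: "m \<in> T" "\<And>k. k \<in> T \<Longrightarrow> k \<le> m"
  shows "kostant_q r (support_root T) =
    [:0, 1:] * (\<Sum>c | 1 \<le> c \<and> c \<le> m \<and> {c..m} \<subseteq> T. kostant_q r (support_root (T - {c..m})))"
proof (rule poly_eqI)
  fix k
  have fT: "finite T" "0 \<notin> T" using T finite_subset by auto
  let ?C = "{c. 1 \<le> c \<and> c \<le> m \<and> {c..m} \<subseteq> T}"
  let ?P = "\<lambda>c n. add_mset (root_seg c m) ` root_partitions r (support_root (T - {c..m})) n"
  have finC: "finite ?C" by (rule finite_subset[of _ "{..m}"]) auto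
  show "coeff (kostant_q r (support_root T)) k = coeff ([:0, 1:] *
    (\<Sum>c\<in>?C. kostant_q r (support_root (T - {c..m})))) k"
  proof (cases k)
    case 0
    have "support_root T \<noteq> 0"
      using root_coeff_support_root[OF fT, of m] m(1) by auto
    then have "root_partitions r (support_root T) 0 = {}"
      by (auto simp: root_partitions_def)
    then show ?thesis using 0 by (simp add: coeff_kostant_q)
  next
    case (Suc n)
    have disj: "?P c n \<inter> ?P d n = {}" if "c \<in> ?C" "d \<in> ?C" "c \<noteq> d" for c d
    proof (rule ccontr)
      assume "?P c n \<inter> ?P d n \<noteq> {}"
      then obtain M N where MN: "add_mset (root_seg c m) M = add_mset (root_seg d m) N"
        "M \<in> root_partitions r (support_root (T - {c..m})) n" by auto
      \<comment> \<open>The two parts are distinct, so the second would occur in \<open>M\<close>,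
        whose sum has coefficient 0 at \<open>m\<close>.\<close>
      have "root_coeff (min c d) (root_seg c m) \<noteq> root_coeff (min c d) (root_seg d m)"
        using that by (auto simp: root_coeff_root_seg min_def)
      then have "root_seg d m \<in># M"
        using MN(1) by (metis insert_noteq_member)
      then have "root_coeff m (root_seg d m) \<le> root_coeff m (support_root (T - {c..m}))"
        using root_coeff_le_sum_mset[of M r] MN(2) by (auto simp: root_partitions_def)
      then show False using that fT by (simp add: root_coeff_root_seg root_coeff_support_root)
    qed
    have P: "root_partitions r (support_root T) (Suc n) = (\<Union>c\<in>?C. ?P c n)"
      using T m by (rule root_partitions_support_root_Suc)
    have "card (\<Union>c\<in>?C. ?P c n) = (\<Sum>c\<in>?C. card (?P c n))"
    proof (rule card_UN_disjoint[OF finC])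
      show "\<forall>c\<in>?C. finite (?P c n)" by (intro ballI finite_imageI finite_root_partitions)
      show "\<forall>c\<in>?C. \<forall>d\<in>?C. c \<noteq> d \<longrightarrow> ?P c n \<inter> ?P d n = {}" using disj by blast
    qed
    moreover have "card (?P c n) = card (root_partitions r (support_root (T - {c..m})) n)" for c
      by (rule card_image) (simp add: inj_on_def)
    ultimately show ?thesis unfolding Suc by (simp add: coeff_kostant_q coeff_sum P)
  qed
qed

text \<open>In the recursion for \<open>insert m T\<close>, the part with \<open>c = m\<close>
  leaves all of \<open>T\<close> and gives q. Longer parts leave \<open>T - {c..m - 1}\<close>; if
  \<open>m - 1 \<in> T\<close>, these are exactly the terms of the recursion for \<open>T\<close>
  itself and give one more copy of its value, otherwise there are none.\<close>

lemma kostant_q_support_root_insert: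
  assumes T: "T \<subseteq> {1..r}" and m: "m \<in> {1..r}" "\<And>k. k \<in> T \<Longrightarrow> k < m"
  shows "kostant_q r (support_root (insert m T)) =
    ([:0, 1:] + (if m - 1 \<in> T then 1 else 0)) * kostant_q r (support_root T)"
proof -
  let ?C = "\<lambda>m T. {c. 1 \<le> c \<and> c \<le> m \<and> {c..m} \<subseteq> T}"
  let ?K = "\<lambda>T. kostant_q r (support_root T)"
  have mT: "m \<notin> T" using m(2) by blast
  have peel: "?K (insert m T) = [:0, 1:] * (\<Sum>c\<in>?C m (insert m T). ?K (insert m T - {c..m}))"
    by (rule kostant_q_support_root_peel) (use T m in \<open>auto intro: less_imp_le\<close>)
  have C: "?C m (insert m T) = insert m (?C (m - 1) T)"
  proof (intro set_eqI iffI)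
    fix c assume c: "c \<in> ?C m (insert m T)"
    then have "{c..m - 1} \<subseteq> T" using m(1) by fastforce
    then show "c \<in> insert m (?C (m - 1) T)" using c by auto
  next
    fix c assume "c \<in> insert m (?C (m - 1) T)"
    moreover have "{c..m} \<subseteq> insert m {c..m - 1}" by auto
    ultimately show "c \<in> ?C m (insert m T)" using m(1) by auto
  qed
  have finC: "finite (?C (m - 1) T)" by (rule finite_subset[of _ "{..m}"]) auto
  have "?K (insert m T) =
      [:0, 1:] * (?K (insert m T - {m..m}) + (\<Sum>c\<in>?C (m - 1) T. ?K (insert m T - {c..m})))"
    unfolding peel C by (subst sum.insert) (use finC m(1) in auto)
  also have "insert m T - {m..m} = T" using mT by auto
  also have "(\<Sum>c\<in>?C (m - 1) T. ?K (insert m T - {c..m})) = (\<Sum>c\<in>?C (m - 1) T. ?K (T - {c..m - 1}))"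
  proof (rule sum.cong[OF refl])
    fix c assume "c \<in> ?C (m - 1) T"
    then have "{c..m} = insert m {c..m - 1}" using m(1) by auto
    then have "insert m T - {c..m} = T - {c..m - 1}" using mT by auto
    then show "?K (insert m T - {c..m}) = ?K (T - {c..m - 1})" by simp
  qed
  finally have eq: "?K (insert m T) =
      [:0, 1:] * ?K T + [:0, 1:] * (\<Sum>c\<in>?C (m - 1) T. ?K (T - {c..m - 1}))"
    by (simp only: distrib_left)
  show ?thesis
  proof (cases "m - 1 \<in> T")
    case True
    then have "?K T = [:0, 1:] * (\<Sum>c\<in>?C (m - 1) T. ?K (T - {c..m - 1}))"
      by (intro kostant_q_support_root_peel T) (use m in fastforce)+
    then have "?K (insert m T) = [:0, 1:] * ?K T + ?K T" using eq by metis
    then show ?thesis using True by (simp add: distrib_right)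
  next
    case False
    then have empty: "?C (m - 1) T = {}" by auto
    show ?thesis using eq False unfolding empty by simp
  qed
qed

lemma kostant_q_support_root_empty: "kostant_q r (support_root {}) = 1"
proof (rule poly_eqI)
  fix k
  have "root_partitions r 0 0 = {{#}}" by (auto simp: root_partitions_def)
  moreover have "root_partitions r 0 k = {}" if "k > 0"
  proof -
    have "M \<notin> root_partitions r 0 k" for M
      using size_le_height[of M r] that by (auto simp: root_partitions_def height_fun_def)
    then show ?thesis by auto
  qed
  ultimately show "coeff (kostant_q r (support_root {})) k = coeff 1 k"
    by (cases k) (auto simp: coeff_kostant_q support_root_def)
qed

section \<open>The alternating sum over sets without consecutive elements\<close>

definition sparse :: "nat set \<Rightarrow> bool" where
  "sparse S \<longleftrightarrow> (\<forall>k\<in>S. Suc k \<notin> S)"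

text \<open>Adding the position \<open>a + n\<close> at the end multiplies the term of \<open>S\<close> by \<open>q\<close> or \<open>q + 1\<close>; the extra
  \<open>1\<close> occurs, for \<open>n > 0\<close>, exactly when \<open>S \<union> {a + n}\<close> is also sparse, and is cancelled by the term of that set.\<close>

lemma sparse_sum_Suc:
  fixes K :: "nat set \<Rightarrow> int poly" and a n :: nat
  defines "f \<equiv> \<lambda>n S. (-1) ^ card S * K ({a..<a + n} - S)"
    and "U \<equiv> \<lambda>n. {S. S \<subseteq> {a..<a + n} \<and> sparse S}"
  assumes a: "a \<ge> 1" and K: "\<And>T. T \<subseteq> {a..<a + n} \<Longrightarrow>
      K (insert (a + n) T) = ([:0, 1:] + (if a + n - 1 \<in> T then 1 else 0)) * K T"
  shows "(\<Sum>S\<in>U (Suc n). f (Suc n) S) =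
    (\<Sum>S\<in>U n. ([:0, 1:] - (if n = 0 then 1 else 0)) * f n S)"
proof -
  let ?V = "{S \<in> U n. a + n - 1 \<notin> S}"
  have finU: "finite (U n)" unfolding U_def by (rule finite_subset[of _ "Pow {a..<a + n}"]) auto
  have split: "U (Suc n) = U n \<union> insert (a + n) ` ?V"
  proof (intro equalityI subsetI)
    fix S assume S: "S \<in> U (Suc n)"
    show "S \<in> U n \<union> insert (a + n) ` ?V"
    proof (cases "a + n \<in> S")
      case True
      have "S - {a + n} \<in> U n" using S by (force simp: U_def sparse_def)
      moreover have "a + n - 1 \<notin> S"
        using S True a by (force simp: U_def sparse_def)
      moreover have "S = insert (a + n) (S - {a + n})" using True by auto
      ultimately show ?thesis by blast
    next
      case False
      moreover have "{a..<a + Suc n} = insert (a + n) {a..<a + n}" by auto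
      ultimately have "S \<in> U n" using S by (auto simp: U_def)
      then show ?thesis by simp
    qed
  next
    fix S assume S: "S \<in> U n \<union> insert (a + n) ` ?V"
    have incl: "S' \<subseteq> {a..<a + Suc n}" "a + n \<notin> S'" "Suc (a + n) \<notin> S'" if "S' \<in> U n" for S'
      using that by (auto simp: U_def)
    show "S \<in> U (Suc n)"
    proof (cases "S \<in> U n")
      case True
      then show ?thesis using incl[OF True] by (simp add: U_def)
    next
      case False
      then obtain S' where S': "S' \<in> U n" "a + n - 1 \<notin> S'" "S = insert (a + n) S'"
        using S by blast
      have "Suc k \<notin> S" if "k \<in> S'" for k
      proof
        assume "Suc k \<in> S"
        moreover have "Suc k \<notin> S'" using that S'(1) by (simp add: U_def sparse_def)
        ultimately have "k = a + n - 1" using S'(3) by simp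
        then show False using that S'(2) by simp
      qed
      then have "sparse S" using S'(3) incl(3)[OF S'(1)] by (simp add: sparse_def)
      then show ?thesis using S'(3) incl(1)[OF S'(1)] by (simp add: U_def)
    qed
  qed
  have notin: "a + n \<notin> S" if "S \<in> U n" for S using that by (auto simp: U_def)
  have inj: "inj_on (insert (a + n)) ?V"
    by (rule inj_onI) (metis (lifting) notin insert_ident mem_Collect_eq)
  have "(\<Sum>S\<in>U (Suc n). f (Suc n) S) =
      (\<Sum>S\<in>U n. f (Suc n) S) + (\<Sum>S\<in>insert (a + n) ` ?V. f (Suc n) S)"
    unfolding split by (rule sum.union_disjoint) (use finU notin in auto)
  also have "(\<Sum>S\<in>insert (a + n) ` ?V. f (Suc n) S) = (\<Sum>S\<in>?V. - f n S)"
  proof (subst sum.reindex[OF inj], rule sum.cong[OF refl])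
    fix S assume S: "S \<in> ?V"
    have "finite S" using S by (auto simp: U_def intro: finite_subset)
    moreover have "{a..<a + Suc n} - insert (a + n) S = {a..<a + n} - S" by auto
    ultimately show "(f (Suc n) \<circ> insert (a + n)) S = - f n S"
      using S notin[of S] by (simp add: f_def)
  qed
  also have "\<dots> = (\<Sum>S\<in>U n. if a + n - 1 \<notin> S then - f n S else 0)"
    by (rule sum.inter_filter[OF finU])
  also have "(\<Sum>S\<in>U n. f (Suc n) S) =
    (\<Sum>S\<in>U n. ([:0, 1:] + (if n > 0 \<and> a + n - 1 \<notin> S then 1 else 0)) * f n S)"
  proof (rule sum.cong[OF refl])
    fix S assume S: "S \<in> U n"
    have "{a..<a + Suc n} - S = insert (a + n) ({a..<a + n} - S)" using notin[OF S] by auto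
    moreover have "a + n - 1 \<in> {a..<a + n} - S \<longleftrightarrow> n > 0 \<and> a + n - 1 \<notin> S" using a by auto
    ultimately show "f (Suc n) S =
        ([:0, 1:] + (if n > 0 \<and> a + n - 1 \<notin> S then 1 else 0)) * f n S"
      using K[of "{a..<a + n} - S"] by (simp only: f_def) (simp add: mult.left_commute)
  qed
  also have "\<dots> + (\<Sum>S\<in>U n. if a + n - 1 \<notin> S then - f n S else 0) =
    (\<Sum>S\<in>U n. ([:0, 1:] - (if n = 0 then 1 else 0)) * f n S)"
    unfolding sum.distrib[symmetric]
  proof (rule sum.cong[OF refl])
    fix S assume S: "S \<in> U n"
    \<comment> \<open>For \<open>n = 0\<close> only the empty set remains: no predecessor in the
      interval gives the extra 1, but the term of \<open>{a}\<close> still contributes, so the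
      factor is q - 1.\<close>
    have "a + n - 1 \<notin> S" if "n = 0" using that S by (auto simp: U_def)
    then show "([:0, 1:] + (if n > 0 \<and> a + n - 1 \<notin> S then 1 else 0)) * f n S +
        (if a + n - 1 \<notin> S then - f n S else 0) =
        ([:0, 1:] - (if n = 0 then 1 else 0)) * f n S"
      by (auto simp del: mult_pCons_left simp: distrib_right left_diff_distrib)
  qed
  finally show ?thesis .
qed

lemma sparse_sum_kostant_q:
  assumes "a \<ge> 1" "a + n \<le> r"
  shows "(\<Sum>S | S \<subseteq> {a..<a + Suc n} \<and> sparse S.
      (-1) ^ card S * kostant_q r (support_root ({a..<a + Suc n} - S))) =
    monom 1 (Suc n) - monom 1 n"
proof -
  have step: "kostant_q r (support_root (insert (a + n) T)) =
      ([:0, 1:] + (if a + n - 1 \<in> T then 1 else 0)) * kostant_q r (support_root T)"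
    if "a + n \<le> r" "T \<subseteq> {a..<a + n}" for n T
  proof (rule kostant_q_support_root_insert)
    have "{a..<a + n} \<subseteq> {1..r}" using that(1) assms(1) by auto
    then show "T \<subseteq> {1..r}" using that(2) by blast
  qed (use that assms(1) in auto)
  show ?thesis using assms(2)
  proof (induction n)
    case 0
    have U: "{S. S \<subseteq> {a..<a + 0} \<and> sparse S} = {{}}" by (auto simp: sparse_def)
    show ?case
    proof (subst sparse_sum_Suc)
      show "(\<Sum>S | S \<subseteq> {a..<a + 0} \<and> sparse S. ([:0, 1:] - (if (0::nat) = 0 then 1 else 0)) *
          ((-1) ^ card S * kostant_q r (support_root ({a..<a + 0} - S)))) =
        monom 1 (Suc 0) - monom 1 0"
        unfolding U by (simp add: kostant_q_support_root_empty monom_Suc)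
    qed (use 0 step[of 0] assms(1) in \<open>blast+\<close>)
  next
    case (Suc n)
    have q: "[:0, 1:] * (monom 1 (Suc n) - monom 1 n) = monom (1::int) (Suc (Suc n)) - monom 1 (Suc n)"
      by (simp add: monom_Suc)
    show ?case
    proof (subst sparse_sum_Suc)
      show "(\<Sum>S | S \<subseteq> {a..<a + Suc n} \<and> sparse S. ([:0, 1:] - (if Suc n = 0 then 1 else 0)) *
          ((-1) ^ card S * kostant_q r (support_root ({a..<a + Suc n} - S)))) =
        monom 1 (Suc (Suc n)) - monom 1 (Suc n)"
        using Suc unfolding q[symmetric] by (simp only: sum_distrib_left[symmetric]) simp
    qed (use Suc.prems step[of "Suc n"] assms(1) in blast)+
  qed
qed

section \<open>Products of commuting adjacent transpositions\<close>

text \<open>For sparse \<open>S\<close> with \<open>0 \<notin> S\<close> this is the product of the transpositions \<open>(k k+1)\<close>, \<open>k \<in> S\<close>.\<close>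

definition adj_swaps :: "nat set \<Rightarrow> nat \<Rightarrow> nat" where
  "adj_swaps S l = (if l \<in> S then Suc l else if l > 0 \<and> l - 1 \<in> S then l - 1 else l)"

text \<open>Neither \<open>k - 1\<close> nor \<open>Suc k\<close> lies in \<open>S\<close>, so
  \<open>adj_swaps S\<close> fixes both \<open>k\<close> and \<open>Suc k\<close>.\<close>

lemma adj_swaps_insert:
  assumes "sparse (insert k S)" "k \<notin> S"
  shows "adj_swaps S \<circ> Transposition.transpose k (Suc k) = adj_swaps (insert k S)"
proof
  fix l
  have "Suc k \<notin> S" "\<not> (k > 0 \<and> k - 1 \<in> S)" using assms
    by (auto simp: sparse_def)
  consider "l = k" | "l = Suc k" | "l \<noteq> k" "l \<noteq> Suc k" by blast
  then show "(adj_swaps S \<circ> Transposition.transpose k (Suc k)) l = adj_swaps (insert k S) l"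
  proof cases
    case 3
    then have "\<not> (l > 0 \<and> l - 1 = k)" by auto
    then show ?thesis using 3 by (auto simp: adj_swaps_def)
  qed (use assms(2) \<open>Suc k \<notin> S\<close> \<open>\<not> (k > 0 \<and> k - 1 \<in> S)\<close> in \<open>auto simp: adj_swaps_def\<close>)
qed

lemma word_action_adj_swaps:
  assumes "set w \<subseteq> {1..r}" "distinct w" "sparse (set w)"
  shows "word_action r w = (\<lambda>v. v \<circ> adj_swaps (set w))"
  using assms
proof (induction w)
  case Nil
  then show ?case by (auto simp: word_action_def adj_swaps_def fun_eq_iff)
next
  case (Cons k w)
  have "sparse (set w)" using Cons.prems(3) by (auto simp: sparse_def)
  then have "word_action r (k # w) = (\<lambda>v. v \<circ> (adj_swaps (set w) \<circ> Transposition.transpose k (Suc k)))"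
    using Cons by (auto simp: word_action_def simple_reflection_transpose fun_eq_iff)
  then show ?case using adj_swaps_insert[of k "set w"] Cons.prems by simp
qed

section \<open>Parity of the length, and recognition of products of adjacent transpositions\<close>

lemma word_action_sign:
  assumes "set w \<subseteq> {1..r}"
  shows "\<exists>p. permutation p \<and> word_action r w = (\<lambda>v. v \<circ> p) \<and> sign p = (-1) ^ length w"
  using assms
proof (induction w)
  case Nil
  show ?case by (rule exI[of _ id]) (auto simp: word_action_def fun_eq_iff)
next
  case (Cons k w)
  then obtain p where p: "permutation p" "word_action r w = (\<lambda>v. v \<circ> p)"
    "sign p = (-1) ^ length w" by (meson set_subset_Cons subset_trans)
  let ?t = "Transposition.transpose k (k + 1)"
  have "sign (p \<circ> ?t) = (-1) ^ length (k # w)"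
    using p by (simp add: sign_compose permutation_swap_id sign_swap_id)
  moreover have "permutation (p \<circ> ?t)"
    using p by (simp add: permutation_compose permutation_swap_id)
  moreover have "word_action r (k # w) = (\<lambda>v. v \<circ> (p \<circ> ?t))"
    using p(2) Cons.prems by (auto simp: word_action_def simple_reflection_transpose fun_eq_iff)
  ultimately show ?case by blast
qed

text \<open>Evaluating at the vector \<open>real\<close>, whose coordinates are pairwise distinct,
  recovers the map.\<close>

lemma precomp_eq_imp_eq:
  fixes p p' :: "nat \<Rightarrow> nat"
  assumes "(\<lambda>v :: nat \<Rightarrow> real. v \<circ> p) = (\<lambda>v. v \<circ> p')"
  shows "p = p'"
proof
  fix l
  have "(real \<circ> p) l = (real \<circ> p') l" using fun_cong[OF assms, of real] by simp
  then show "p l = p' l" by simp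
qed

text \<open>A shortest word and \<open>w\<close> induce the same permutation, whose sign fixes the
  parity of both lengths. The sign in the multiplicity formula can thus be read off any
  word.\<close>

lemma weyl_length_parity:
  assumes "set w \<subseteq> {1..r}"
  shows "(-1 :: int poly) ^ weyl_length r (word_action r w) = (-1) ^ length w"
proof -
  have "\<exists>w'. length w' = weyl_length r (word_action r w) \<and> set w' \<subseteq> {1..r} \<and>
      word_action r w' = word_action r w"
    unfolding weyl_length_def by (rule LeastI[of _ "length w"]) (use assms in blast)
  then obtain w' where w': "length w' = weyl_length r (word_action r w)" "set w' \<subseteq> {1..r}"
      "word_action r w' = word_action r w" by blast
  obtain p where p: "word_action r w = (\<lambda>v. v \<circ> p)" "sign p = (-1) ^ length w"
    using word_action_sign[OF assms] by blast
  obtain p' where p': "word_action r w' = (\<lambda>v. v \<circ> p')" "sign p' = (-1) ^ length w'"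
    using word_action_sign[OF w'(2)] by blast
  have "p = p'" using p p' w'(3) by (intro precomp_eq_imp_eq) simp
  then have "(-1 :: int) ^ length w = (-1) ^ length w'" using p p' by simp
  then have "even (length w) \<longleftrightarrow> even (length w')"
    by (metis minus_one_power_iff one_neq_neg_one)
  then show ?thesis by (simp add: w'(1)[symmetric] minus_one_power_iff)
qed

text \<open>Scan the coordinates from the left. Whenever the first \<open>k\<close> values fill
  \<open>{1..k}\<close>, the bound allows \<open>p (Suc k)\<close> to be only \<open>Suc k\<close>
  or \<open>Suc (Suc k)\<close>; in the latter case \<open>Suc k\<close> is skipped, and the bound
  forces it to be the next value.\<close>

lemma permutes_eq_adj_swaps:
  assumes p: "p permutes {1..N}"
    and D: "\<And>k. k \<le> N \<Longrightarrow> (\<Sum>l=1..k. int (p l) - int l) \<le> (if k \<in> R then 1 else 0)"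
  obtains S where "S \<subseteq> R" "sparse S" "p = adj_swaps S"
proof -
  define S where "S = {k. p k = Suc k}"
  have S_N: "l \<in> {1..N}" if "l \<in> S" for l
    using that permutes_not_in[OF p, of l] by (auto simp: S_def)
  have inv: "(\<forall>l\<in>{1..k}. p l = adj_swaps S l \<and> (l \<in> S \<longrightarrow> l - 1 \<notin> S)) \<and>
      p ` {1..k} = (if k \<in> S then insert (Suc k) {1..<k} else {1..k}) \<and>
      (\<Sum>l=1..k. int (p l) - int l) = (if k \<in> S then 1 else 0)" if "k \<le> N" for k
    using that
  proof (induction k)
    case 0
    have "0 \<notin> S" using S_N by fastforce
    then show ?case by simp
  next
    case (Suc k)
    then have IH: "\<forall>l\<in>{1..k}. p l = adj_swaps S l \<and> (l \<in> S \<longrightarrow> l - 1 \<notin> S)"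
      "p ` {1..k} = (if k \<in> S then insert (Suc k) {1..<k} else {1..k})"
      "(\<Sum>l=1..k. int (p l) - int l) = (if k \<in> S then 1 else 0)" by auto
    have img: "p ` {1..Suc k} = insert (p (Suc k)) (p ` {1..k})"
      by (simp add: atLeastAtMostSuc_conv)
    have new: "p (Suc k) \<notin> p ` {1..k}"
    proof
      assume "p (Suc k) \<in> p ` {1..k}"
      then obtain l where "l \<le> k" "p (Suc k) = p l" by auto
      then show False using injD[OF permutes_inj[OF p], of "Suc k" l] by simp
    qed
    have pos: "p (Suc k) \<ge> 1"
      using permutes_in_image[OF p, of "Suc k"] Suc.prems by simp
    have sum: "(\<Sum>l=1..Suc k. int (p l) - int l) =
        (if k \<in> S then 1 else 0) + (int (p (Suc k)) - int (Suc k))"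
      using IH(3) by simp
    have le: "(if k \<in> S then 1 else 0) + (int (p (Suc k)) - int (Suc k)) \<le> 1"
      using D[OF Suc.prems] sum by (auto split: if_splits)
    show ?case
    proof (cases "k \<in> S")
      case True
      \<comment> \<open>The sum is already 1, so \<open>p (Suc k) \<le> Suc k\<close>, and
        \<open>k\<close> is the only such value not yet taken.\<close>
      then have "p (Suc k) = k" using new IH(2) le pos by auto
      moreover from this have "Suc k \<notin> S" by (simp add: S_def)
      moreover have "insert k (insert (Suc k) {1..<k}) = {1..Suc k}" using S_N[OF True] by auto
      moreover have "\<forall>l\<in>{1..Suc k}. p l = adj_swaps S l \<and> (l \<in> S \<longrightarrow> l - 1 \<notin> S)"
        using True IH(1) calculation by (auto simp: adj_swaps_def le_Suc_eq)
      ultimately show ?thesis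
        using True IH(2) sum img by auto
    next
      case False
      then have "p (Suc k) = Suc k \<or> p (Suc k) = Suc (Suc k)" using new IH(2) le pos by auto
      moreover have "insert (Suc k) {1..k} = {1..Suc k}" "{1..<Suc k} = {1..k}" by auto
      moreover have "Suc k \<in> S \<longleftrightarrow> p (Suc k) = Suc (Suc k)" by (simp add: S_def)
      moreover have "\<forall>l\<in>{1..Suc k}. p l = adj_swaps S l \<and> (l \<in> S \<longrightarrow> l - 1 \<notin> S)"
        using False IH(1) calculation by (auto simp: adj_swaps_def le_Suc_eq)
      ultimately show ?thesis
        using False IH(2) sum img by auto
    qed
  qed
  show ?thesis
  proof
    show "S \<subseteq> R"
    proof
      fix k assume "k \<in> S"
      then have "k \<le> N" "(\<Sum>l=1..k. int (p l) - int l) = 1"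
        using inv[of k] S_N[of k] unfolding atLeastAtMost_iff by presburger+
      then show "k \<in> R" using D[of k] by (simp split: if_splits)
    qed
    show "sparse S"
      unfolding sparse_def
    proof (intro ballI notI)
      fix k assume k: "k \<in> S" "Suc k \<in> S"
      then have "Suc k \<le> N" "Suc k \<in> {1..Suc k}" using S_N[of "Suc k"] by simp_all
      with inv[of "Suc k"] k(2) have "Suc k - 1 \<notin> S" by blast
      then show False using k(1) by simp
    qed
    show "p = adj_swaps S"
    proof
      fix l
      show "p l = adj_swaps S l"
      proof (cases "l \<in> {1..N}")
        case True
        then have "l \<le> N" "l \<in> {1..l}" by simp_all
        with inv[of l] show ?thesis by blast
      next
        case False
        \<comment> \<open>The point \<open>Suc N\<close> is outside the permuted range;
          \<open>adj_swaps S\<close> fixes it only because \<open>N\<close> is not in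
          \<open>S\<close>.\<close>
        have "N \<notin> S"
          using permutes_in_image[OF p, of N] S_N[of N] by (auto simp: S_def)
        then have "\<not> (l > 0 \<and> l - 1 \<in> S)" using False S_N[of "l - 1"] by (cases "l = Suc N") auto
        then show ?thesis
          using False S_N[of l] permutes_not_in[OF p False] by (auto simp: adj_swaps_def)
      qed
    qed
  qed
qed

section \<open>The Weyl vector\<close>

lemma sum_apply: "(\<Sum>x\<in>A. f x) k = (\<Sum>x\<in>A. f x k)"
  by (induction A rule: infinite_finite_induct) simp_all

lemma root_seg_eq_std_basis:
  assumes "c \<le> d"
  shows "root_seg c d = std_basis c - std_basis (Suc d)"
  using assms
proof (induction d rule: dec_induct)
  case base
  then show ?case by (simp add: root_seg_def simple_root_def)
next
  case (step d)
  then show ?case by (simp add: root_seg_def simple_root_def)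
qed

text \<open>The nonzero root coefficients occupy the interval from \<open>c\<close> to
  \<open>d\<close>, which recovers both ends. This lets the sum over \<open>pos_roots\<close> be
  reindexed by pairs.\<close>

lemma inj_on_root_seg: "inj_on (\<lambda>(c, d). root_seg c d) {(c, d). 1 \<le> c \<and> c \<le> d}"
proof (rule inj_onI, clarify)
  fix c d c' d' :: nat
  assume *: "1 \<le> c" "c \<le> d" "1 \<le> c'" "c' \<le> d'" "root_seg c d = root_seg c' d'"
  have "c \<le> k \<and> k \<le> d \<longleftrightarrow> c' \<le> k \<and> k \<le> d'" for k
    using arg_cong[OF *(5), of "root_coeff k"]
    unfolding root_coeff_root_seg[OF *(1)] root_coeff_root_seg[OF *(3)]
    by (metis zero_neq_one)
  from this[of c] this[of d] this[of c'] this[of d'] * show "c = c' \<and> d = d'" by auto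
qed

text \<open>Coordinate \<open>k\<close> is 1 in the r + 1 - k roots that start at \<open>k\<close>
  and -1 in the k - 1 roots that end at \<open>k - 1\<close>; \<rho> takes half the
  difference.\<close>

lemma weyl_rho_eq:
  assumes k: "k \<in> {1..r + 1}"
  shows "weyl_rho r k = (real r + 2) / 2 - real k"
proof -
  let ?I = "Sigma {1..r} (\<lambda>c. {c..r})"
  have "pos_roots r = (\<lambda>(c, d). root_seg c d) ` ?I"
    unfolding pos_roots_def by force
  moreover have "inj_on (\<lambda>(c, d). root_seg c d) ?I"
    by (rule inj_on_subset[OF inj_on_root_seg]) auto
  ultimately have "(\<Sum>\<beta>\<in>pos_roots r. \<beta>) = (\<Sum>(c, d)\<in>?I. root_seg c d)"
    by (simp add: sum.reindex case_prod_unfold)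
  also have "\<dots> = (\<Sum>(c, d)\<in>?I. std_basis c - std_basis (Suc d))"
    by (rule sum.cong) (auto simp: root_seg_eq_std_basis)
  finally have "(\<Sum>\<beta>\<in>pos_roots r. \<beta>) k = (\<Sum>(c, d)\<in>?I. std_basis c k - std_basis (Suc d) k)"
    by (simp add: sum_apply case_prod_unfold)
  also have "\<dots> = (\<Sum>(c, d)\<in>?I. std_basis c k) - (\<Sum>(c, d)\<in>?I. std_basis (Suc d) k)"
    by (simp add: sum_subtractf case_prod_unfold)
  also have "(\<Sum>(c, d)\<in>?I. std_basis c k) = real (card ({p\<in>?I. k = fst p}))"
    by (simp add: std_basis_def case_prod_unfold sum.inter_filter[symmetric])
  also have "{p\<in>?I. k = fst p} = Pair k ` {k..r}" using k by auto
  also have "card \<dots> = r + 1 - k" by (simp add: card_image inj_on_def)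
  also have "(\<Sum>(c, d)\<in>?I. std_basis (Suc d) k) = real (card ({p\<in>?I. k = Suc (snd p)}))"
    by (simp add: std_basis_def case_prod_unfold sum.inter_filter[symmetric])
  also have "{p\<in>?I. k = Suc (snd p)} = (\<lambda>c. (c, k - 1)) ` {1..k - 1}" using k by auto
  also have "card \<dots> = k - 1" by (simp add: card_image inj_on_def)
  finally show ?thesis using k by (simp add: weyl_rho_def of_nat_diff field_simps)
qed

section \<open>The weight \<theta> + \<rho> under permutations of the coordinates\<close>

lemma support_root_apply:
  assumes "finite S"
  shows "support_root S l =
    (if l \<in> S then 1 else 0) - (if l > 0 \<and> l - 1 \<in> S then 1 else 0)"
proof -
  have "support_root S l = (\<Sum>k\<in>S. (if l = k then 1 else 0) - (if l > 0 \<and> l - 1 = k then 1 else 0))"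
    unfolding support_root_def sum_apply
    by (rule sum.cong) (auto simp: simple_root_def std_basis_def)
  also have "\<dots> = (\<Sum>k\<in>S. if l = k then 1 else 0) - (\<Sum>k\<in>S. if l > 0 \<and> l - 1 = k then 1 else 0)"
    by (rule sum_subtractf)
  also have "(\<Sum>k\<in>S. if l > 0 \<and> l - 1 = k then 1 else (0::real)) =
      (if l > 0 \<and> l - 1 \<in> S then 1 else 0)"
    using assms by (cases "l > 0") simp_all
  finally show ?thesis using assms by simp
qed

definition theta_rho :: "nat \<Rightarrow> nat \<Rightarrow> real" where
  "theta_rho r = highest_root r + weyl_rho r"

lemma theta_rho_eq:
  assumes "k \<in> {1..r + 1}" "r \<ge> 1"
  shows "theta_rho r k =
    (real r + 2) / 2 - real k + (if k = 1 then 1 else 0) - (if k = r + 1 then 1 else 0)"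
  using assms by (simp add: theta_rho_def highest_root_def root_seg_eq_std_basis weyl_rho_eq std_basis_def)

text \<open>Strict dominance of \<theta> + \<rho>: replacing the first coordinate by another lowers
  it, replacing the last raises it, and this pins down the end points.\<close>

lemma theta_rho_less:
  assumes "k \<in> {1..r + 1}" "l \<in> {1..r + 1}" "k < l"
  shows "theta_rho r l < theta_rho r k"
  using assms by (simp add: theta_rho_eq)

text \<open>The outer simple roots do not occur in \<open>\<theta> - \<mu>\<close>, which forces \<open>p\<close> to fix both end points; on
  the remaining coordinates \<open>\<theta> + \<rho>\<close> is an arithmetic progression.\<close>

lemma kostant_q_nonzero_imp_adj_swaps:
  assumes p: "p permutes {1..r + 1}" and R: "R \<subseteq> {2..r - 1}" and r: "r \<ge> 1"
    and nz: "kostant_q r ((theta_rho r \<circ> p) - theta_rho r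
      + support_root R) \<noteq> 0"
  obtains S where "S \<subseteq> R" "sparse S" "p = adj_swaps S"
proof -
  define x where "x = theta_rho r"
  have finR: "finite R" "0 \<notin> R" using R finite_subset by auto
  have x: "x k = (real r + 2) / 2 - real k + (if k = 1 then 1 else 0) - (if k = r + 1 then 1 else 0)"
    if "k \<in> {1..r + 1}" for k unfolding x_def using theta_rho_eq[OF that r] .
  have D: "(\<Sum>l=1..k. x l - x (p l)) \<le> (if k \<in> R then 1 else 0)" for k
  proof -
    have "root_coeff k ((x \<circ> p) - x + support_root R) \<ge> 0"
      using nz kostant_q_eq_0[of k] unfolding x_def by force
    then have "root_coeff k ((x \<circ> p) - x) + (if k \<in> R then 1 else 0) \<ge> 0"
      unfolding root_coeff_add root_coeff_support_root[OF finR] .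
    then show ?thesis by (simp add: root_coeff_def sum_subtractf)
  qed
  have p_in: "p k \<in> {1..r + 1}" if "k \<in> {1..r + 1}" for k
    using permutes_in_image[OF p] that by blast
  have p1: "p 1 = 1"
  proof (rule ccontr)
    assume "p 1 \<noteq> 1"
    then have "x (p 1) < x 1"
      using p_in[of 1] unfolding x_def by (intro theta_rho_less) auto
    then show False using D[of 1] R by (auto split: if_splits)
  qed
  \<comment> \<open>A permutation preserves the total, so the bound at \<open>k = r\<close> becomes
    one on coordinate \<open>r + 1\<close>.\<close>
  have total: "(\<Sum>l=1..r + 1. x (p l)) = (\<Sum>l=1..r + 1. x l)"
    using sum.permute[OF p, of x] by (simp add: o_def)
  have p2: "p (r + 1) = r + 1"
  proof (rule ccontr)
    assume "p (r + 1) \<noteq> r + 1"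
    then have "x (r + 1) < x (p (r + 1))"
      using p_in[of "r + 1"] unfolding x_def by (intro theta_rho_less) auto
    moreover have "r \<notin> R" using R r by fastforce
    ultimately show False using D[of r] total by (simp add: sum_subtractf)
  qed
  have step: "x l - x (p l) = real_of_int (int (p l) - int l)" if "l \<in> {1..r + 1}" for l
  proof -
    \<comment> \<open>With both ends fixed, the corrections from \<theta> at 1 and
      \<open>r + 1\<close> agree at \<open>l\<close> and \<open>p l\<close>, so only the index
      difference is left.\<close>
    have "p l = 1 \<longleftrightarrow> l = 1" "p l = r + 1 \<longleftrightarrow> l = r + 1"
      using p1 p2 permutes_inj[OF p] by (metis injD)+
    then show ?thesis using x[OF that] x[OF p_in[OF that]] by simp
  qed
  have "(\<Sum>l=1..k. int (p l) - int l) \<le> (if k \<in> R then 1 else 0)" if "k \<le> r + 1" for k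
  proof -
    have "real_of_int (\<Sum>l=1..k. int (p l) - int l) = (\<Sum>l=1..k. x l - x (p l))"
      unfolding of_int_sum by (rule sum.cong) (use step that in auto)
    also have "\<dots> \<le> real_of_int (if k \<in> R then 1 else 0)" using D[of k] by (auto split: if_splits)
    finally show ?thesis by (simp only: of_int_le_iff)
  qed
  with p show thesis by (rule permutes_eq_adj_swaps) (assumption, rule that)
qed

text \<open>For \<open>k\<close> in \<open>{2..r - 1}\<close> the coordinates \<open>k\<close> and
  \<open>Suc k\<close> of \<theta> + \<rho> differ by 1, so swapping them subtracts the k-th simple
  root; sparseness keeps the swaps disjoint.\<close>

lemma theta_rho_adj_swaps:
  assumes S: "S \<subseteq> {2..r - 1}" "sparse S"
  shows "theta_rho r \<circ> adj_swaps S =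
    theta_rho r - support_root S"
proof
  fix l
  define x where "x = theta_rho r"
  have fin: "finite S" using S finite_subset by auto
  have down: "x (Suc k) = x k - 1" if "k \<in> S" for k
  proof -
    have "k \<in> {2..r - 1}" using that S by blast
    then have "k \<in> {1..r + 1}" "Suc k \<in> {1..r + 1}" "r \<ge> 1" "k \<noteq> 1" "Suc k \<noteq> r + 1" by auto
    then show ?thesis unfolding x_def by (simp add: theta_rho_eq)
  qed
  have "x (adj_swaps S l) = x l - support_root S l"
  proof (cases "l \<in> S")
    case True
    then have "\<not> (l > 0 \<and> l - 1 \<in> S)" using S(2) by (force simp: sparse_def)
    then show ?thesis using True down[of l] by (auto simp: adj_swaps_def support_root_apply[OF fin])
  next
    case False
    then show ?thesis using down[of "l - 1"]
      by (auto simp: adj_swaps_def support_root_apply[OF fin])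
  qed
  then show "(theta_rho r \<circ> adj_swaps S) l =
      (theta_rho r - support_root S) l"
    by (simp add: x_def)
qed

section \<open>Evaluation of the sum over the Weyl group\<close>

theorem theorem1p4:
  fixes r i j :: nat
  assumes "r \<ge> 3"
    and "i \<in> {1..r - 2}"
    and "j \<in> {1..r - i - 1}"
  shows "weight_mult_q r (highest_root r) (root_seg 1 i + root_seg (i + j + 1) r)
    = monom 1 j - monom 1 (j - 1)"
proof -
  define x where "x = theta_rho r"
  define R where "R = {i + 1..<i + 1 + j}"
  define U where "U = {S. S \<subseteq> R \<and> sparse S}"
  define act :: "nat set \<Rightarrow> (nat \<Rightarrow> real) \<Rightarrow> nat \<Rightarrow> real" where "act = (\<lambda>S v. v \<circ> adj_swaps S)"
  define \<mu> where "\<mu> = root_seg 1 i + root_seg (i + j + 1) r"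
  define g where "g = (\<lambda>\<sigma>. (-1) ^ weyl_length r \<sigma> * kostant_q r (\<sigma> x - weyl_rho r - \<mu>))"
  have R: "R \<subseteq> {2..r - 1}" using assms by (auto simp: R_def)
  have word: "act S \<in> weyl_group r \<and> (-1 :: int poly) ^ weyl_length r (act S) = (-1) ^ card S"
    if "S \<in> U" for S
  proof -
    have "{2..r - 1} \<subseteq> {1..r}" by auto
    then have "R \<subseteq> {1..r}" using R by (rule subset_trans[rotated])
    then have S: "S \<subseteq> {1..r}" "sparse S" using that unfolding U_def by blast+
    then obtain w where w: "set w = S" "distinct w"
      using finite_distinct_list[of S] finite_subset by blast
    have "act S = word_action r w" using w S by (simp add: act_def word_action_adj_swaps)
    then show ?thesis
      using w S weyl_length_parity[of w r] distinct_card[of w] by (auto simp: weyl_group_def)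
  qed
  have "{1..r} = {1..i} \<union> R \<union> {i + j + 1..r}" using assms by (auto simp: R_def)
  then have "highest_root r = support_root {1..i} + support_root R + support_root {i + j + 1..r}"
    unfolding highest_root_def root_seg_eq_support_root support_root_def
    by (subst sum.union_disjoint[symmetric], (auto simp: R_def)[3])+ simp
  then have theta: "highest_root r = support_root R + \<mu>"
    by (simp add: \<mu>_def root_seg_eq_support_root)
  \<comment> \<open>Replaces \<rho> + \<mu> by \<theta> + \<rho> minus the sum over
    \<open>R\<close>, the form in which the preceding lemmas treat the argument.\<close>
  have arg: "v - weyl_rho r - \<mu> = v - x + support_root R" for v
    by (simp add: x_def theta_rho_def theta algebra_simps)
  have val: "kostant_q r (act S x - weyl_rho r - \<mu>) = kostant_q r (support_root (R - S))"
    if "S \<in> U" for S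
  proof -
    have S: "S \<subseteq> R" "sparse S" using that by (auto simp: U_def)
    have "act S x = x - support_root S"
      unfolding act_def x_def by (rule theta_rho_adj_swaps) (use S R in auto)
    then show ?thesis unfolding arg using S by (simp add: support_root_diff R_def)
  qed
  have zero: "g \<sigma> = 0" if \<sigma>: "\<sigma> \<in> weyl_group r - act ` U" for \<sigma>
  proof (rule ccontr)
    assume nz: "g \<sigma> \<noteq> 0"
    obtain p where p: "p permutes {1..r + 1}" "\<sigma> = (\<lambda>v. v \<circ> p)"
      using \<sigma> word_action_permutes by (force simp: weyl_group_def)
    have "kostant_q r ((x \<circ> p) - x + support_root R) \<noteq> 0"
      using nz unfolding g_def arg p(2) by force
    then obtain S where "S \<subseteq> R" "sparse S" "p = adj_swaps S"
      using kostant_q_nonzero_imp_adj_swaps[OF p(1) R] assms(1) unfolding x_def by auto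
    then show False using \<sigma> p(2) by (auto simp: U_def act_def)
  qed
  have inj: "inj_on act U"
  proof (rule inj_onI)
    fix S T assume "act S = act T"
    then have eq: "adj_swaps S = adj_swaps T" unfolding act_def by (rule precomp_eq_imp_eq)
    \<comment> \<open>The set is recovered as the points that its swap moves up by one.\<close>
    have "l \<in> A \<longleftrightarrow> adj_swaps A l = Suc l" for A l by (auto simp: adj_swaps_def)
    then have "A = {l. adj_swaps A l = Suc l}" for A by blast
    then show "S = T" using eq by metis
  qed
  have "weight_mult_q r (highest_root r) \<mu> = (\<Sum>\<sigma>\<in>weyl_group r. g \<sigma>)"
    by (simp add: weight_mult_q_def g_def x_def theta_rho_def)
  also have "\<dots> = (\<Sum>\<sigma>\<in>act ` U. g \<sigma>)"
    by (rule sum.mono_neutral_right) (use finite_weyl_group zero word in auto)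
  also have "\<dots> = (\<Sum>S\<in>U. (-1) ^ card S * kostant_q r (support_root (R - S)))"
    unfolding sum.reindex[OF inj] by (rule sum.cong) (use word val in \<open>auto simp: g_def\<close>)
  also have "\<dots> = monom 1 j - monom 1 (j - 1)"
  proof -
    \<comment> \<open>The interval has \<open>j\<close> elements while the lemma counts
      \<open>Suc n\<close>, hence \<open>n = j - 1\<close>; this uses
      \<open>j \<ge> 1\<close>.\<close>
    have "Suc (j - 1) = j" "i + 1 + (j - 1) \<le> r" using assms by auto
    then show ?thesis using sparse_sum_kostant_q[of "i + 1" "j - 1" r] by (simp add: U_def R_def)
  qed
  finally show ?thesis by (simp add: \<mu>_def)
qed

end
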